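(* For every $\varepsilon>0$ there is $n_0$ such that for every $n\ge n_0$ there is a set of at most $n^{\,n^{\frac12+\varepsilon}}$ permutations of $[n]=\{1,\dots,n\}$ such that any word containing all these permutations as subsequences is of length at least $\left(\frac1e-\varepsilon\right)n^2$.
   Context: Permutations of $[n]$ are regarded as words $i_1i_2\dots i_n$ in which each element of $[n]$ appears exactly once. A subsequence of a word is obtained by deleting some (possibly no) letters; its letters need not be contiguous. Here $e$ is Euler's number. *)

theory Defs
  imports Complex_Main "HOL-Library.Sublist" "HOL-Combinatorics.Multiset_Permutations"
begin

end

theory Submission
  imports Defs "HOL-Real_Asymp.Real_Asymp"
begin

text \<open>
  Polynomially many random permutations suffice. Cut a permutation of $[n]$ into blocks of length
  $s \approx \sqrt n$. A uniformly random block occurs as a subsequence of a fixed word of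
  length $D \approx c s n$ with probability at most
  $\binom{D}{s} (n-s)!/n! \approx (D e/(s n))^s \approx (c e)^s$, which for $c < 1/e$ beats any
  polynomial in $n$. A word shorter than about $c n^2$ containing the permutation must contain
  some block within a window of length $D$; a union bound over blocks and windows shows that the
  word misses at least half of all permutations. Repeatedly choosing a permutation that is
  missed by at least half of the remaining words deals with all short words in $O(n^3)$ steps.
\<close>

section \<open>Blocks of a subsequence and windows of a word\<close>

text \<open>Induction peels off the first block. Split \<open>w\<close> into \<open>us\<close>,
  which contains this block, and \<open>vs\<close>, which contains the rest of \<open>p\<close>.
  Either \<open>us\<close> fits into the window of length \<open>D\<close> at the start, or more
  than \<open>D\<close> letters are used up and \<open>vs\<close> is short enough for the remaining
  \<open>m\<close> blocks.\<close>

lemma subseq_block_in_window: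
  assumes "subseq p w" "m * s \<le> length p" "length w < m * D"
  shows "\<exists>j<m. \<exists>q\<le>length w. subseq (take s (drop (j * s) p)) (take D (drop q w))"
  using assms
proof (induction m arbitrary: p w)
  case 0
  then show ?case by simp
next
  case (Suc m)
  from Suc.prems(1) have "subseq (take s p @ drop s p) w" by simp
  then obtain us vs where w: "w = us @ vs" and u: "subseq (take s p) us"
      and v: "subseq (drop s p) vs"
    by (blast dest: list_emb_appendD)
  show ?case
  proof (cases "length us \<le> D")
    case True
    then have "subseq us (take D w)"
      using w True by (simp add: list_emb_prefix)
    with u have "subseq (take s p) (take D w)"
      by (rule subseq_order.trans)
    then have "subseq (take s (drop (0 * s) p)) (take D (drop 0 w))"
      by simp
    then show ?thesis by blast
  next
    case False
    have "\<exists>j<m. \<exists>q\<le>length vs. subseq (take s (drop (j * s) (drop s p))) (take D (drop q vs))"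
      by (rule Suc.IH[OF v]) (use False Suc.prems w in auto)
    then obtain j q where j: "j < m" "q \<le> length vs"
      and sub: "subseq (take s (drop (j * s) (drop s p))) (take D (drop q vs))"
      by blast
    have "take s (drop (Suc j * s) p) = take s (drop (j * s) (drop s p))"
      by (simp add: add.commute)
    moreover have "drop (length us + q) w = drop q vs"
      using w by simp
    ultimately have "subseq (take s (drop (Suc j * s) p)) (take D (drop (length us + q) w))"
      using sub by simp
    moreover have "Suc j < Suc m" "length us + q \<le> length w"
      using j w by auto
    ultimately show ?thesis by blast
  qed
qed

section \<open>Counting the permutations contained in a fixed word\<close>

lemma subseqs_of_length_eq_nths:
  "{xs. subseq xs v \<and> length xs = s} = nths v ` {I. I \<subseteq> {..<length v} \<and> card I = s}"
proof (intro equalityI subsetI)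
  fix xs assume "xs \<in> {xs. subseq xs v \<and> length xs = s}"
  then obtain N where N: "xs = nths v N" "length xs = s"
    by (auto simp: subseq_conv_nths)
  \<comment> \<open>The set \<open>N\<close> may contain numbers that are not positions of
    \<open>v\<close>. Cutting them off leaves the subsequence unchanged and makes the number of
    indices equal to its length.\<close>
  have eq: "nths v (N \<inter> {..<length v}) = nths v N"
    unfolding nths_def by (rule arg_cong[where f = "map fst"], rule filter_cong) (auto dest: set_zip_rightD)
  have "{i. i < length v \<and> i \<in> N} = N \<inter> {..<length v}" by auto
  then have "card (N \<inter> {..<length v}) = s"
    using N by (simp add: length_nths)
  with N eq show "xs \<in> nths v ` {I. I \<subseteq> {..<length v} \<and> card I = s}"
    by (intro image_eqI[where x = "N \<inter> {..<length v}"]) auto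
next
  fix xs assume "xs \<in> nths v ` {I. I \<subseteq> {..<length v} \<and> card I = s}"
  then obtain I where I: "xs = nths v I" "I \<subseteq> {..<length v}" "card I = s" by auto
  have "{i. i < length v \<and> i \<in> I} = I" using I(2) by auto
  then show "xs \<in> {xs. subseq xs v \<and> length xs = s}"
    using I by (auto simp: subseq_conv_nths length_nths)
qed

lemma
  shows finite_subseqs_of_length: "finite {xs. subseq xs v \<and> length xs = s}"
    and card_subseqs_of_length_le:
      "card {xs. subseq xs v \<and> length xs = s} \<le> length v choose s"
proof -
  have fin: "finite {I. I \<subseteq> {..<length v} \<and> card I = s}" by simp
  show "finite {xs. subseq xs v \<and> length xs = s}"
    unfolding subseqs_of_length_eq_nths using fin by (rule finite_imageI)
  have "card {I. I \<subseteq> {..<length v} \<and> card I = s} = length v choose s"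
    using n_subsets[of "{..<length v}" s] by simp
  then show "card {xs. subseq xs v \<and> length xs = s} \<le> length v choose s"
    unfolding subseqs_of_length_eq_nths using card_image_le[OF fin, of "nths v"] by simp
qed

text \<open>Deleting a prescribed block at a prescribed place loses no information, and what remains
  is a permutation of the letters outside the block.\<close>

lemma card_perms_with_block_le:
  assumes "finite A" "length b = s"
  shows "card {p \<in> permutations_of_set A. take s (drop i p) = b} \<le> fact (card A - s)"
    (is "card ?S \<le> _")
proof (cases "?S = {}")
  case False
  define f where "f = (\<lambda>p :: 'a list. take i p @ drop (i + s) p)"
  have split: "p = take i p @ b @ drop (i + s) p" if "p \<in> ?S" for p
  proof -
    have "p = take i p @ take s (drop i p) @ drop s (drop i p)"
      by (simp only: append_take_drop_id)
    then show ?thesis using that by (simp add: add.commute)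
  qed
  \<comment> \<open>A single witness already forces \<open>b\<close> to consist of distinct letters
    of \<open>A\<close>, so exactly \<open>card A - s\<close> letters remain outside it.\<close>
  from False obtain p0 where p0: "p0 \<in> ?S" by blast
  have b: "distinct b" "set b \<subseteq> A"
  proof -
    have "distinct p0" "set p0 = A" using p0 by (auto simp: permutations_of_set_def)
    moreover have "b = take s (drop i p0)" using p0 by simp
    ultimately show "distinct b" "set b \<subseteq> A"
      by (auto dest!: in_set_takeD in_set_dropD)
  qed
  have "inj_on f ?S"
  proof (rule inj_onI)
    fix p p' assume p: "p \<in> ?S" "p' \<in> ?S" "f p = f p'"
    have "length p = length p'"
      using p by (auto simp: length_finite_permutations_of_set)
    then have "take i p = take i p' \<and> drop (i + s) p = drop (i + s) p'"
      using p(3) by (auto simp: f_def)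
    then show "p = p'" using split[OF p(1)] split[OF p(2)] by metis
  qed
  moreover have "f ` ?S \<subseteq> permutations_of_set (A - set b)"
  proof
    fix r assume "r \<in> f ` ?S"
    then obtain p where p: "p \<in> ?S" "r = f p" by blast
    have "distinct (take i p @ b @ drop (i + s) p)" "set (take i p @ b @ drop (i + s) p) = A"
      using p(1) split[OF p(1)] by (auto simp: permutations_of_set_def)
    then show "r \<in> permutations_of_set (A - set b)"
      unfolding p(2) f_def permutations_of_set_def by auto
  qed
  ultimately have "card ?S \<le> card (permutations_of_set (A - set b))"
    using assms(1) by (intro card_inj_on_le) auto
  also have "\<dots> = fact (card A - s)"
    using b assms by (simp add: card_Diff_subset distinct_card)
  finally show ?thesis .
next
  case True
  then show ?thesis by (simp only: card.empty)
qed

text \<open>Union bound over the values the block can take. As \<open>i + s \<le> card A\<close>,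
  the block has exactly \<open>s\<close> letters, so these values are among the
  length-\<open>s\<close> subsequences of \<open>v\<close>.\<close>

lemma card_perms_block_subseq_le:
  assumes "finite A" "i + s \<le> card A" "length v \<le> D"
  shows "card {p \<in> permutations_of_set A. subseq (take s (drop i p)) v}
           \<le> (D choose s) * fact (card A - s)"
proof -
  let ?B = "{b. subseq b v \<and> length b = s}"
  have "{p \<in> permutations_of_set A. subseq (take s (drop i p)) v}
      \<subseteq> (\<Union>b\<in>?B. {p \<in> permutations_of_set A. take s (drop i p) = b})"
    using assms by (auto simp: length_finite_permutations_of_set)
  then have "card {p \<in> permutations_of_set A. subseq (take s (drop i p)) v}
      \<le> card (\<Union>b\<in>?B. {p \<in> permutations_of_set A. take s (drop i p) = b})"
    using assms finite_subseqs_of_length by (intro card_mono finite_UN_I) auto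
  also have "\<dots> \<le> (\<Sum>b\<in>?B. card {p \<in> permutations_of_set A. take s (drop i p) = b})"
    by (rule card_UN_le[OF finite_subseqs_of_length])
  also have "\<dots> \<le> (\<Sum>b\<in>?B. fact (card A - s))"
    by (rule sum_mono, rule card_perms_with_block_le) (use assms in auto)
  also have "\<dots> = card ?B * fact (card A - s)" by simp
  also have "\<dots> \<le> (D choose s) * fact (card A - s)"
    using card_subseqs_of_length_le[of v s] binomial_right_mono[OF assms(3), of s]
    by (intro mult_right_mono) auto
  finally show ?thesis .
qed

text \<open>Union bound over the \<open>m\<close> blocks and the \<open>length w + 1\<close>
  starting points of a window.\<close>

lemma card_perms_subseq_le:
  assumes "finite A" "m * s \<le> card A" "length w < m * D"
  shows "card {p \<in> permutations_of_set A. subseq p w}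
           \<le> m * (length w + 1) * ((D choose s) * fact (card A - s))"
proof -
  let ?S = "\<lambda>(j, q). {p \<in> permutations_of_set A.
    subseq (take s (drop (j * s) p)) (take D (drop q w))}"
  let ?I = "{..<m} \<times> {..length w}"
  have "{p \<in> permutations_of_set A. subseq p w} \<subseteq> (\<Union>x\<in>?I. ?S x)"
  proof
    fix p assume p: "p \<in> {p \<in> permutations_of_set A. subseq p w}"
    then have "length p = card A"
      using length_finite_permutations_of_set by blast
    with assms(2) have "m * s \<le> length p" by simp
    with p assms(3) show "p \<in> (\<Union>x\<in>?I. ?S x)"
      using subseq_block_in_window[of p w m s D] by fastforce
  qed
  then have "card {p \<in> permutations_of_set A. subseq p w} \<le> card (\<Union>x\<in>?I. ?S x)"
    using assms by (intro card_mono finite_UN_I) auto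
  also have "\<dots> \<le> (\<Sum>x\<in>?I. card (?S x))"
    by (rule card_UN_le) simp
  also have "\<dots> \<le> (\<Sum>x\<in>?I. (D choose s) * fact (card A - s))"
  proof (rule sum_mono)
    fix x assume x: "x \<in> ?I"
    obtain j q where jq: "x = (j, q)" by fastforce
    have "Suc j * s \<le> m * s" using x jq by (intro mult_right_mono) auto
    then have "j * s + s \<le> card A" using assms(2) by simp
    then show "card (?S x) \<le> (D choose s) * fact (card A - s)"
      unfolding jq prod.case by (intro card_perms_block_subseq_le) (use assms in auto)
  qed
  finally show ?thesis by simp
qed

section \<open>From counting to a small set of permutations\<close>

text \<open>Each \<open>x\<close> is related to at most half of \<open>Y\<close>, so by double
  counting some \<open>y\<close> is related to at most half of \<open>X\<close>. Put this
  \<open>y\<close> into \<open>P\<close> and recurse on the \<open>x\<close> still related to it;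
  after \<open>k\<close> halvings nothing is left.\<close>

lemma halving_hitting_set:
  assumes "finite X" "finite Y" "Y \<noteq> {}"
    and "\<And>x. x \<in> X \<Longrightarrow> 2 * card {y \<in> Y. R x y} \<le> card Y"
    and "card X < 2 ^ k"
  shows "\<exists>P\<subseteq>Y. card P \<le> k \<and> (\<forall>x\<in>X. \<exists>y\<in>P. \<not> R x y)"
  using assms(1,4,5)
proof (induction k arbitrary: X)
  case 0
  then show ?case by (intro exI[of _ "{}"]) auto
next
  case (Suc k)
  have "\<exists>y\<in>Y. 2 * card {x \<in> X. R x y} \<le> card X"
  proof (rule ccontr)
    assume "\<not> ?thesis"
    then have "(\<Sum>y\<in>Y. card X) < (\<Sum>y\<in>Y. 2 * card {x \<in> X. R x y})"
      using assms by (intro sum_strict_mono) (auto simp: not_le)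
    also have "\<dots> = 2 * (\<Sum>y\<in>Y. \<Sum>x\<in>{x \<in> X. R x y}. 1)"
      by (simp add: sum_distrib_left)
    also have "\<dots> = 2 * (\<Sum>x\<in>X. \<Sum>y\<in>{y \<in> Y. R x y}. 1)"
      using sum.swap_restrict[of Y X "\<lambda>_ _. 1 :: nat" "\<lambda>y x. R x y"] assms(2) Suc.prems(1)
      by simp
    also have "\<dots> = (\<Sum>x\<in>X. 2 * card {y \<in> Y. R x y})"
      by (simp add: sum_distrib_left)
    also have "\<dots> \<le> (\<Sum>x\<in>X. card Y)"
      by (rule sum_mono) (rule Suc.prems)
    finally show False by (simp add: mult.commute)
  qed
  then obtain y where y: "y \<in> Y" "2 * card {x \<in> X. R x y} \<le> card X" by blast
  have "\<exists>P\<subseteq>Y. card P \<le> k \<and> (\<forall>x\<in>{x \<in> X. R x y}. \<exists>y\<in>P. \<not> R x y)"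
    by (rule Suc.IH) (use Suc.prems y in auto)
  then obtain P where P: "P \<subseteq> Y" "card P \<le> k" "\<forall>x\<in>{x \<in> X. R x y}. \<exists>y\<in>P. \<not> R x y"
    by blast
  have "card (insert y P) \<le> Suc k"
    using P(2) card_insert_le_m1 by (metis card_insert_if finite_subset P(1) assms(2) le_SucI Suc_le_mono)
  then show ?case using P y by (intro exI[of _ "insert y P"]) auto
qed

text \<open>The halving argument is run on words of length exactly \<open>L\<close> over
  \<open>{0..n}\<close>. The assumption \<open>half\<close> says that the union bound leaves each
  such word with at most half of all permutations.\<close>

lemma exists_unembeddable_perms:
  fixes n L m s D :: nat
  assumes "m * s \<le> n" "L < m * D"
    and half: "2 * (m * (L + 1) * ((D choose s) * fact (n - s))) \<le> fact n"
  shows "\<exists>P\<subseteq>permutations_of_set {1..n}. card P \<le> n * L + 1 \<and>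
           (\<forall>w :: nat list. length w \<le> L \<longrightarrow> (\<exists>p\<in>P. \<not> subseq p w))"
proof -
  let ?X = "{w. set w \<subseteq> {0..n} \<and> length w = L}"
  let ?Y = "permutations_of_set {1..n}"
  have "\<exists>P\<subseteq>?Y. card P \<le> n * L + 1 \<and> (\<forall>w\<in>?X. \<exists>p\<in>P. \<not> subseq p w)"
  proof (rule halving_hitting_set)
    show "finite ?X" by (rule finite_lists_length_eq) simp
    show "2 * card {p \<in> ?Y. subseq p w} \<le> card ?Y" if "w \<in> ?X" for w
    proof -
      have "card {p \<in> ?Y. subseq p w} \<le> m * (L + 1) * ((D choose s) * fact (n - s))"
        using card_perms_subseq_le[of "{1..n}" m s w D] that assms by simp
      then show ?thesis using half by simp
    qed
    have "card ?X = Suc n ^ L"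
      using card_lists_length_eq[of "{0..n}" L] by simp
    \<comment> \<open>The crude bound \<open>Suc n \<le> 2 ^ n\<close> turns the number of words
      into a power of two, and the extra 1 in the exponent makes the inequality strict.\<close>
    also have "\<dots> \<le> (2 ^ n) ^ L"
      by (rule power_mono) (simp_all add: Suc_le_eq)
    also have "\<dots> < 2 ^ (n * L + 1)"
      by (simp add: power_mult)
    finally show "card ?X < 2 ^ (n * L + 1)" .
  qed auto
  then obtain P where P: "P \<subseteq> ?Y" "card P \<le> n * L + 1"
    and hit: "\<And>w. w \<in> ?X \<Longrightarrow> \<exists>p\<in>P. \<not> subseq p w" by blast
  \<comment> \<open>The letter 0 does not occur in the permutations, so it serves as padding and replaces
    foreign letters; this leaves only finitely many words to hit.\<close>
  have "\<exists>p\<in>P. \<not> subseq p w" if len: "length w \<le> L" for w :: "nat list"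
  proof -
    define f where "f = (\<lambda>x. if x \<le> n then x else 0)"
    define w' where "w' = map f w @ replicate (L - length w) 0"
    have "w' \<in> ?X" using len by (auto simp: w'_def f_def)
    then obtain p where p: "p \<in> P" "\<not> subseq p w'" using hit by blast
    have "map f p = p"
      using p(1) P(1) by (intro map_idI) (force simp: f_def permutations_of_set_def)
    then have "subseq p w'" if "subseq p w"
      unfolding w'_def using subseq_map[OF that, of f] by (simp add: list_emb_prefix)
    with p show ?thesis by blast
  qed
  with P show ?thesis by blast
qed

section \<open>Estimates for factorials and binomial coefficients\<close>

text \<open>The quotient \<open>s ^ s / fact s\<close> is a single term of the exponential series at
  \<open>s\<close>, whose terms are all nonnegative.\<close>

lemma power_div_exp_le_fact: "(real s / exp 1) ^ s \<le> fact s"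
proof -
  have "real s ^ s / fact s \<le> exp (real s)"
  proof -
    have "(\<lambda>k. real s ^ k /\<^sub>R fact k) sums exp (real s)" by (rule exp_converges)
    then have "sum (\<lambda>k. real s ^ k /\<^sub>R fact k) {s} \<le> exp (real s)"
      using sums_unique sums_summable sum_le_suminf[of "\<lambda>k. real s ^ k /\<^sub>R fact k" "{s}"] by force
    then show ?thesis by (simp add: field_simps scaleR_conv_of_real)
  qed
  then show ?thesis
    by (simp add: power_divide exp_of_nat_mult[symmetric] field_simps flip: exp_of_nat_mult)
qed

lemma power_mult_fact_le_fact: "a ^ s * fact a \<le> (fact (a + s) :: nat)"
proof (induction s)
  case (Suc s)
  have "a ^ Suc s * fact a = a * (a ^ s * fact a)" by simp
  also have "\<dots> \<le> (a + Suc s) * fact (a + s)"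
    using Suc.IH by (intro mult_mono) auto
  finally show ?case by simp
qed simp

text \<open>After division by \<open>fact n\<close> the left side bounds the probability that a
  random block embeds into a given window, so \<rho> is the decay rate per letter. The factor
  \<open>exp 1\<close> in the hypothesis comes from bounding \<open>fact s\<close> below by
  \<open>(s / exp 1) ^ s\<close>.\<close>

lemma binomial_mult_fact_le:
  assumes "0 < s" "s \<le> n" "0 \<le> \<rho>"
    and D: "exp 1 * real D \<le> \<rho> * (real s * real (n - s))"
  shows "real ((D choose s) * fact (n - s)) \<le> \<rho> ^ s * fact n"
proof -
  have "real D \<le> (real s / exp 1) * (\<rho> * real (n - s))"
    using D by (simp add: field_simps)
  then have "real D ^ s \<le> ((real s / exp 1) * (\<rho> * real (n - s))) ^ s"
    by (rule power_mono) simp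
  moreover have "real (D choose s) * fact s \<le> real D ^ s"
    using binomial_fact_pow[of D s] by (metis of_nat_fact of_nat_le_iff of_nat_mult of_nat_power)
  moreover have "real (D choose s) * (real s / exp 1) ^ s \<le> real (D choose s) * fact s"
    by (intro mult_left_mono power_div_exp_le_fact) simp
  ultimately have "(real s / exp 1) ^ s * real (D choose s)
      \<le> (real s / exp 1) ^ s * (\<rho> * real (n - s)) ^ s"
    by (simp only: power_mult_distrib mult.commute)
  then have "real (D choose s) \<le> (\<rho> * real (n - s)) ^ s"
    using assms(1) by (subst (asm) mult_le_cancel_left_pos) auto
  then have "real (D choose s) * fact (n - s) \<le> (\<rho> * real (n - s)) ^ s * fact (n - s)"
    by (rule mult_right_mono) simp
  also have "\<dots> = \<rho> ^ s * real ((n - s) ^ s * fact (n - s))"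
    by (simp add: power_mult_distrib)
  also have "\<dots> \<le> \<rho> ^ s * real (fact n)"
    using power_mult_fact_le_fact[of "n - s" s] assms by (intro mult_left_mono of_nat_mono) auto
  finally show ?thesis by simp
qed

section \<open>Choice of the parameters\<close>

text \<open>The inequalities assumed on \<open>n\<close> hold for all large \<open>n\<close>. The
  first pays for replacing \<open>n\<close> by \<open>n - s\<close> in the decay rate, the second
  for the rounding in \<open>m\<close>, \<open>s\<close> and \<open>D\<close>, and
  \<open>decay\<close> pushes the union bound below one half.\<close>

lemma exists_few_unembeddable_perms:
  fixes \<epsilon> \<delta> :: real and n :: nat
  defines "\<delta> \<equiv> exp 1 * \<epsilon> / 4"
  assumes eps: "0 < \<epsilon>" "\<epsilon> < 1 / exp 1"
    and n: "1 \<le> n" "sqrt n \<le> \<delta> * n" "sqrt n + 1 \<le> \<epsilon> / 2 * n"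
    and decay: "2 * (n * (real n ^ 2 + 1)) * exp (ln (1 - \<delta>) * (sqrt n - 1)) \<le> 1"
  shows "\<exists>P\<subseteq>permutations_of_set {1..n}. card P \<le> n ^ 3 + 1 \<and>
           (\<forall>w :: nat list. (\<forall>p\<in>P. subseq p w) \<longrightarrow>
             (1 / exp 1 - \<epsilon>) * (real n)^2 \<le> real (length w))"
proof -
  \<comment> \<open>The constant \<open>c\<close> lies midway between the target
    \<open>1 / exp 1 - \<epsilon>\<close> and the threshold \<open>1 / exp 1\<close>: the lower gap
    absorbs rounding, the upper gap gives exponential decay.\<close>
  define c where "c = 1 / exp 1 - \<epsilon> / 2"
  define s where "s = nat \<lfloor>sqrt n\<rfloor>"
  define m where "m = n div s"
  define D where "D = nat \<lfloor>c * s * n\<rfloor>"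
  define L where "L = nat \<lfloor>(1 / exp 1 - \<epsilon>) * (real n)^2\<rfloor>"
  have "exp 1 * \<epsilon> < 1" using eps by (simp add: field_simps)
  then have \<delta>: "0 < \<delta>" "\<delta> < 1 / 4" using eps by (simp_all add: \<delta>_def)
  have e1: "1 / exp 1 < (1 :: real)" by simp
  have "0 < c" unfolding c_def using eps by linarith
  moreover have "c < 1" unfolding c_def using eps e1 by linarith
  ultimately have c: "0 < c" "c < 1" by auto
  have ec: "exp 1 * c = 1 - 2 * \<delta>"
    by (simp add: c_def \<delta>_def field_simps)
  have s: "real s \<le> sqrt n" "sqrt n - 1 < real s"
    unfolding s_def by auto
  have "1 \<le> sqrt n" using n by simp
  then have "1 \<le> s" unfolding s_def by (simp add: le_nat_iff)
  have "sqrt n \<le> n"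
    using n mult_left_mono[of 1 "sqrt n" "sqrt n"] \<open>1 \<le> sqrt n\<close> by simp
  then have "s \<le> n" using s by linarith
  have ms: "m * s \<le> n" unfolding m_def by (rule div_times_less_eq_dividend)
  have "m \<le> n" unfolding m_def by simp
  have "1 \<le> m" unfolding m_def using \<open>1 \<le> s\<close> \<open>s \<le> n\<close> by (simp add: Suc_le_eq div_greater_zero_iff)
  have "n < m * s + s"
    unfolding m_def using \<open>1 \<le> s\<close> by (simp add: dividend_less_div_times add.commute)
  then have ms': "real n - real s \<le> real m * real s"
    by (simp flip: of_nat_mult)
  have D: "real D \<le> c * s * n" "c * s * n - 1 < real D"
    unfolding D_def using c by auto
  have T0: "0 \<le> (1 / exp 1 - \<epsilon>) * (real n)^2" using eps by simp
  then have L: "real L \<le> (1 / exp 1 - \<epsilon>) * (real n)^2"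
    unfolding L_def by (simp add: of_nat_nat)
  also have "\<dots> \<le> 1 * (real n)^2"
    by (rule mult_right_mono) (use eps e1 in linarith, simp)
  finally have Ln: "L \<le> n\<^sup>2" by (simp flip: of_nat_power)
  have LmD: "L < m * D"
  proof -
    \<comment> \<open>The \<open>m\<close> blocks miss fewer than \<open>s\<close> letters of the
      permutation, at a cost of at most \<open>c * s * n\<close>, and rounding \<open>D\<close> down
      costs at most \<open>m \<le> n\<close>. Together this is at most
      \<open>(sqrt n + 1) * n\<close>, which fits into the gap of \<open>\<epsilon> / 2 * n\<close>
      times \<open>n\<close>.\<close>
    have "real L \<le> c * (real n)^2 - (\<epsilon> / 2 * n) * n"
      using L by (simp add: c_def algebra_simps power2_eq_square)
    also have "\<dots> \<le> c * (real n)^2 - (sqrt n + 1) * n"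
      using n by (intro diff_left_mono mult_right_mono) auto
    also have "\<dots> = c * (real n)^2 - 1 * sqrt n * n - n"
      by (simp add: algebra_simps)
    also have "\<dots> \<le> c * (real n)^2 - c * real s * n - m"
      using c s \<open>m \<le> n\<close> by (intro diff_mono mult_mono order_refl) auto
    also have "\<dots> = (real n - real s) * (c * n) - m"
      by (simp add: algebra_simps power2_eq_square)
    also have "\<dots> \<le> (real m * real s) * (c * n) - m"
      using c by (intro diff_right_mono mult_right_mono ms') auto
    also have "\<dots> = real m * (c * s * n - 1)"
      by (simp add: algebra_simps)
    also have "\<dots> < real m * real D"
      using D \<open>1 \<le> m\<close> by (intro mult_strict_left_mono) auto
    finally show ?thesis by (simp flip: of_nat_mult)
  qed
  have "exp 1 * real D \<le> (1 - \<delta>) * (real s * real (n - s))"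
  proof -
    \<comment> \<open>One of the two \<delta> in \<open>exp 1 * c = 1 - 2 * \<delta>\<close> is
      spent on passing from \<open>n\<close> to \<open>n - s\<close>; the other remains as the decay
      rate \<open>1 - \<delta>\<close>.\<close>
    have "(1 - 2 * \<delta>) * n \<le> (1 - \<delta>) * n - 1 * sqrt n"
      using n by (simp add: algebra_simps)
    also have "\<dots> \<le> (1 - \<delta>) * n - (1 - \<delta>) * s"
      using s \<delta> by (intro diff_left_mono mult_mono) auto
    also have "\<dots> = (1 - \<delta>) * real (n - s)"
      using \<open>s \<le> n\<close> by (simp add: algebra_simps)
    finally have "real s * ((1 - 2 * \<delta>) * n) \<le> real s * ((1 - \<delta>) * real (n - s))"
      by (rule mult_left_mono) simp
    moreover have "exp 1 * real D \<le> exp 1 * (c * s * n)"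
      by (intro mult_left_mono D) simp
    moreover have "exp 1 * (c * s * n) = real s * ((1 - 2 * \<delta>) * n)"
      using ec by (simp add: ac_simps)
    ultimately show ?thesis by (simp only: ac_simps)
  qed
  then have "real ((D choose s) * fact (n - s)) \<le> (1 - \<delta>) ^ s * fact n"
    using \<open>1 \<le> s\<close> \<open>s \<le> n\<close> \<delta> by (intro binomial_mult_fact_le) auto
  also have "(1 - \<delta>) ^ s = exp (ln (1 - \<delta>) * s)"
    using \<delta> by (simp add: exp_of_nat2_mult)
  \<comment> \<open>The logarithm is negative, so the lower bound \<open>sqrt n - 1\<close> for
    \<open>s\<close> gives an upper bound here.\<close>
  also have "\<dots> \<le> exp (ln (1 - \<delta>) * (sqrt n - 1))"
    using s \<delta> by (simp add: mult_left_mono_neg)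
  finally have block: "real ((D choose s) * fact (n - s))
      \<le> exp (ln (1 - \<delta>) * (sqrt n - 1)) * fact n"
    by simp
  have "real (m * (L + 1)) \<le> real (n * (n\<^sup>2 + 1))"
    using \<open>m \<le> n\<close> Ln by (intro of_nat_mono mult_mono) auto
  then have "2 * (real (m * (L + 1)) * real ((D choose s) * fact (n - s)))
      \<le> 2 * (real (n * (n\<^sup>2 + 1)) * (exp (ln (1 - \<delta>) * (sqrt n - 1)) * fact n))"
    by (intro mult_left_mono mult_mono block) auto
  also have "\<dots> = (2 * (n * (real n ^ 2 + 1)) * exp (ln (1 - \<delta>) * (sqrt n - 1))) * fact n"
    by (simp add: algebra_simps)
  also have "\<dots> \<le> 1 * fact n"
    by (rule mult_right_mono[OF decay]) simp
  finally have "real (2 * (m * (L + 1) * ((D choose s) * fact (n - s)))) \<le> real (fact n)"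
    by simp
  then have half: "2 * (m * (L + 1) * ((D choose s) * fact (n - s))) \<le> fact n"
    by (simp only: of_nat_le_iff)
  obtain P where P: "P \<subseteq> permutations_of_set {1..n}" "card P \<le> n * L + 1"
    "\<And>w :: nat list. length w \<le> L \<Longrightarrow> \<exists>p\<in>P. \<not> subseq p w"
    using exists_unembeddable_perms[OF ms LmD half] by blast
  have "n * L \<le> n * n\<^sup>2" using Ln by (rule mult_left_mono) simp
  also have "\<dots> = n ^ 3" by (simp add: eval_nat_numeral)
  finally have "card P \<le> n ^ 3 + 1" using P(2) by linarith
  moreover have "(1 / exp 1 - \<epsilon>) * (real n)^2 \<le> real (length w)"
    if "\<forall>p\<in>P. subseq p w" for w :: "nat list"
  proof -
    \<comment> \<open>Since \<open>L\<close> is the floor of the target, an integer length exceeding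
      \<open>L\<close> exceeds the target itself.\<close>
    have "L < length w" using P(3)[of w] that by (meson not_le)
    then show ?thesis unfolding L_def by linarith
  qed
  ultimately show ?thesis using P(1) by blast
qed

section \<open>Passage to large \<open>n\<close>\<close>

text \<open>From 16 on the exponent is at least \<open>sqrt n \<ge> 4\<close>, while
  \<open>n ^ 3 + 1 \<le> n ^ 4\<close>.\<close>

lemma cube_plus_one_le_powr_powr:
  assumes "16 \<le> n" "0 < \<epsilon>"
  shows "real (n ^ 3 + 1) \<le> real n powr (real n powr (1/2 + \<epsilon>))"
proof -
  have "n ^ 3 + 1 \<le> n ^ 3 * 2"
    using assms by simp
  also have "\<dots> \<le> n ^ 3 * n"
    using assms by (intro mult_left_mono) auto
  also have "\<dots> = n ^ 4" using power_Suc2[of n 3] by simp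
  finally have "real (n ^ 3 + 1) \<le> real (n ^ 4)" by (rule of_nat_mono)
  also have "\<dots> = real n powr 4"
    using assms by simp
  also have "\<dots> \<le> real n powr (real n powr (1/2 + \<epsilon>))"
  proof (rule powr_mono)
    have "4 \<le> sqrt n" using assms by (intro real_le_rsqrt) simp
    also have "\<dots> = real n powr (1/2)" by (simp add: powr_half_sqrt)
    also have "\<dots> \<le> real n powr (1/2 + \<epsilon>)"
      using assms by (intro powr_mono) auto
    finally show "4 \<le> real n powr (1/2 + \<epsilon>)" .
  qed (use assms in simp)
  finally show ?thesis .
qed

theorem theorem9:
  shows "\<forall>\<epsilon>::real. \<epsilon> > 0 \<longrightarrow>
    (\<exists>n0::nat. \<forall>n\<ge>n0.
      \<exists>P \<subseteq> permutations_of_set {1..n}.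
        real (card P) \<le> real n powr (real n powr (1/2 + \<epsilon>)) \<and>
        (\<forall>w :: nat list. (\<forall>p\<in>P. subseq p w) \<longrightarrow>
          real (length w) \<ge> (1 / exp 1 - \<epsilon>) * (real n)^2))"
proof (intro allI impI)
  fix \<epsilon> :: real
  assume eps: "0 < \<epsilon>"
  show "\<exists>n0::nat. \<forall>n\<ge>n0. \<exists>P \<subseteq> permutations_of_set {1..n}.
        real (card P) \<le> real n powr (real n powr (1/2 + \<epsilon>)) \<and>
        (\<forall>w :: nat list. (\<forall>p\<in>P. subseq p w) \<longrightarrow>
          real (length w) \<ge> (1 / exp 1 - \<epsilon>) * (real n)^2)"
  proof (cases "\<epsilon> < 1 / exp 1")
    \<comment> \<open>The claimed lower bound is nonpositive here, so even the empty set of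
      permutations works.\<close>
    case False
    then have "(1 / exp 1 - \<epsilon>) * (real n)^2 \<le> real k" for n k :: nat
      by (intro order_trans[OF mult_nonpos_nonneg]) auto
    then show ?thesis
      by (intro exI[of _ 0] allI impI exI[of _ "{}"]) auto
  next
    case True
    define \<delta> where "\<delta> = exp 1 * \<epsilon> / 4"
    have "exp 1 * \<epsilon> < 1" using True by (simp add: field_simps)
    then have \<delta>: "0 < \<delta>" "\<delta> < 1" using eps by (simp_all add: \<delta>_def)
    then have "ln (1 - \<delta>) < 0" by simp
    have "eventually (\<lambda>n::nat. sqrt n \<le> \<delta> * n) at_top"
      using \<delta> by real_asymp
    moreover have "eventually (\<lambda>n::nat. sqrt n + 1 \<le> \<epsilon> / 2 * n) at_top"
      using eps by real_asymp
    \<comment> \<open>For any negative rate \<open>k\<close>, exponential decay in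
      \<open>sqrt n\<close> beats the cubic number of block-window pairs.\<close>
    moreover have "eventually (\<lambda>n::nat.
        2 * (n * (real n ^ 2 + 1)) * exp (k * (sqrt n - 1)) \<le> 1) at_top" if "k < 0" for k :: real
      using that by real_asymp
    note this[OF \<open>ln (1 - \<delta>) < 0\<close>]
    ultimately have "eventually (\<lambda>n::nat. sqrt n \<le> \<delta> * n \<and> sqrt n + 1 \<le> \<epsilon> / 2 * n \<and>
        2 * (n * (real n ^ 2 + 1)) * exp (ln (1 - \<delta>) * (sqrt n - 1)) \<le> 1 \<and> 16 \<le> n) at_top"
      by (intro eventually_conj eventually_ge_at_top)
    then obtain n0 where n0: "\<And>n::nat. n \<ge> n0 \<Longrightarrow> sqrt n \<le> \<delta> * n \<and> sqrt n + 1 \<le> \<epsilon> / 2 * n \<and>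
        2 * (n * (real n ^ 2 + 1)) * exp (ln (1 - \<delta>) * (sqrt n - 1)) \<le> 1 \<and> 16 \<le> n"
      unfolding eventually_at_top_linorder by blast
    show ?thesis
    proof (intro exI[of _ n0] allI impI)
      fix n assume "n0 \<le> n"
      note n = n0[OF this]
      obtain P where P: "P \<subseteq> permutations_of_set {1..n}" "card P \<le> n ^ 3 + 1"
        "\<forall>w :: nat list. (\<forall>p\<in>P. subseq p w) \<longrightarrow>
             (1 / exp 1 - \<epsilon>) * (real n)^2 \<le> real (length w)"
        using exists_few_unembeddable_perms[of \<epsilon> n] eps True n unfolding \<delta>_def by auto
      have "real (card P) \<le> real (n ^ 3 + 1)" using P(2) by (rule of_nat_mono)
      also have "\<dots> \<le> real n powr (real n powr (1/2 + \<epsilon>))"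
        using n eps by (intro cube_plus_one_le_powr_powr) auto
      finally show "\<exists>P \<subseteq> permutations_of_set {1..n}.
          real (card P) \<le> real n powr (real n powr (1/2 + \<epsilon>)) \<and>
          (\<forall>w :: nat list. (\<forall>p\<in>P. subseq p w) \<longrightarrow>
            real (length w) \<ge> (1 / exp 1 - \<epsilon>) * (real n)^2)"
        using P by blast
    qed
  qed
qed

end
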